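(* The total log-determinant (TLD) mean for a set of $m$ Hermitian positive-definite matrices $\{\bm{X}_1,\bm{X}_2,\dots,\bm{X}_m\}$ is given by $$\overline{\bm{X}}_{TLD}=\left(\sum_{j=1}^m\sqrt{1+\|\bm{X}_j^{-1}\|^2}\times\sum_{i=1}^m\frac{\bm{X}_i^{-1}}{\sqrt{1+\|\bm{X}_i^{-1}\|^2}}\right)^{-1}.$$
   Context: The matrices are $N\times N$ complex Hermitian positive-definite; $\mathscr{P}(N,\mathbb{C})$ denotes the set of all such matrices, and $\|\bm{X}\|=\sqrt{\operatorname{tr}(\bm{X}^{\mathrm H}\bm{X})}$ is the Frobenius norm, with $\bm{X}^{\mathrm H}$ the conjugate transpose. The TLD divergence on Hermitian positive-definite matrices is $$\delta(\bm{X},\bm{Y})=\frac{\ln\det(\bm{Y}\bm{X}^{-1})+\operatorname{tr}(\bm{Y}^{-1}\bm{X})-N}{\sqrt{1+\|\bm{Y}^{-1}\|^2}},$$ i.e. the total Bregman divergence generated by $F(\bm{X})=-\ln\det\bm{X}$. The TLD mean is defined as $$\overline{\bm{X}}:=\underset{\bm{X}\in\mathscr{P}(N,\mathbb{C})}{\operatorname{argmin}}\ \frac1m\sum_{i=1}^m\delta(\bm{X},\bm{X}_i).$$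
   Formalization: The printed factor Σ_j √(1+‖X_j^{-1}‖²) is replaced by (Σ_j 1/√(1+‖X_j^{-1}‖²))^{-1}; as printed the formula fails for every m ≥ 2 (X_1 = X_2 = X gives X/4 instead of X), and the two agree for m = 1. *)

theory Defs
  imports "HOL-Analysis.Analysis"
begin

definition conj_transpose :: "complex^'n^'m \<Rightarrow> complex^'m^'n" where
  "conj_transpose X = map_matrix cnj (transpose X)"

definition hermitian :: "complex^'n^'n \<Rightarrow> bool" where
  "hermitian X \<longleftrightarrow> conj_transpose X = X"

(* For a Hermitian matrix the sum below is real, so taking its real part loses nothing. *)
definition hermitian_pos_def :: "complex^'n^'n \<Rightarrow> bool" where
  "hermitian_pos_def X \<longleftrightarrow>
     hermitian X \<and> (\<forall>v. v \<noteq> 0 \<longrightarrow> 0 < Re (\<Sum>i\<in>UNIV. cnj (v $ i) * (X *v v) $ i))"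

definition frobenius_norm :: "complex^'n^'n \<Rightarrow> real" where
  "frobenius_norm X = sqrt (Re (trace (conj_transpose X ** X)))"

lemma frobenius_norm_eq_norm: "frobenius_norm X = norm X"
proof -
  have "Re (trace (conj_transpose X ** X)) = (\<Sum>i\<in>UNIV. \<Sum>k\<in>UNIV. (norm (X $ k $ i))\<^sup>2)"
    unfolding cmod_power2
    by (simp add: trace_def conj_transpose_def matrix_matrix_mult_def transpose_def
        power2_eq_square)
  also have "\<dots> = (\<Sum>k\<in>UNIV. \<Sum>i\<in>UNIV. (norm (X $ k $ i))\<^sup>2)"
    by (rule sum.swap)
  also have "\<dots> = (norm X)\<^sup>2"
    by (simp add: norm_vec_def L2_set_def sum_nonneg)
  finally show ?thesis
    by (simp add: frobenius_norm_def)
qed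

(* The total Bregman divergence generated by F X = - ln (det X). For Hermitian positive-definite
   X and Y, det (Y X^-1) is a positive real and tr (Y^-1 X) is real, so the real parts only
   change the type. *)
definition TLD_divergence :: "complex^'n^'n \<Rightarrow> complex^'n^'n \<Rightarrow> real" where
  "TLD_divergence X Y =
     (ln (Re (det (Y ** matrix_inv X))) + Re (trace (matrix_inv Y ** X)) - real CARD('n))
       / sqrt (1 + (frobenius_norm (matrix_inv Y))\<^sup>2)"

definition is_TLD_mean :: "nat \<Rightarrow> (nat \<Rightarrow> complex^'n^'n) \<Rightarrow> complex^'n^'n \<Rightarrow> bool" where
  "is_TLD_mean m Xs =
     is_arg_min (\<lambda>X. 1 / real m * (\<Sum>i = 1..m. TLD_divergence X (Xs i))) hermitian_pos_def"

end

theory Submission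
  imports Defs
begin

text \<open>
  Put \<open>w\<^sub>i = 1 / sqrt (1 + \<parallel>X\<^sub>i\<^sup>-\<^sup>1\<parallel>\<^sup>2)\<close>, \<open>W = \<Sum>w\<^sub>i\<close> and \<open>A = W\<^sup>-\<^sup>1 \<Sum>w\<^sub>i X\<^sub>i\<^sup>-\<^sup>1\<close>. Up to a constant the objective is a
  positive multiple of \<open>tr (A X) - ln det X\<close>. Symmetric Gaussian elimination writes \<open>A = P\<^sup>H P\<close>, so with
  \<open>B = P X P\<^sup>H\<close> it remains to minimise \<open>tr B - ln det B\<close>. Eliminating once more turns \<open>B\<close> into
  a diagonal matrix with the same determinant and with pivots \<open>d\<^sub>i \<le> B\<^sub>i\<^sub>i\<close>, all of them equal only if
  \<open>B\<close> is diagonal; hence \<open>tr B - ln det B \<ge> \<Sum>(d\<^sub>i - ln d\<^sub>i) \<ge> N\<close> with equality only for \<open>B = I\<close>,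
  that is \<open>X = A\<^sup>-\<^sup>1\<close>.
\<close>

section \<open>Diagonal matrices, conjugate transposes and inverses\<close>

definition real_diag :: "('n \<Rightarrow> real) \<Rightarrow> complex^'n^'n" where
  "real_diag d = (\<chi> i j. if i = j then of_real (d i) else 0)"

lemma real_diag_nth [simp]: "real_diag d $ i $ j = (if i = j then of_real (d i) else 0)"
  by (simp add: real_diag_def)

lemma det_real_diag: "det (real_diag d) = of_real (\<Prod>i\<in>UNIV. d i)"
  by (subst det_diagonal) auto

lemma conj_transpose_nth [simp]: "conj_transpose A $ i $ j = cnj (A $ j $ i)"
  by (simp add: conj_transpose_def transpose_def)

lemma conj_transpose_conj_transpose [simp]: "conj_transpose (conj_transpose A) = A"
  by (simp add: vec_eq_iff)

lemma conj_transpose_mult: "conj_transpose (A ** B) = conj_transpose B ** conj_transpose A"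
  by (simp add: vec_eq_iff matrix_matrix_mult_def mult.commute)

lemma conj_transpose_mat_1 [simp]: "conj_transpose (mat 1) = mat 1"
  by (simp add: vec_eq_iff mat_def)

lemma det_conj_transpose: "det (conj_transpose A) = cnj (det A)"
proof -
  have "det (conj_transpose A) = det (map_matrix cnj A)"
    unfolding conj_transpose_def by (subst det_transpose [symmetric])
      (auto simp: transpose_def vec_eq_iff intro!: arg_cong [where f = det])
  also have "\<dots> = cnj (det A)"
    by (simp add: det_def)
  finally show ?thesis .
qed

text \<open>Adjointness for the form in \<open>hermitian_pos_def\<close>; it lets a congruence move
  its outer factor onto the test vector.\<close>

lemma sum_cnj_mult_matrix_vector:
  "(\<Sum>i\<in>UNIV. cnj (v $ i) * (C *v u) $ i) = (\<Sum>i\<in>UNIV. cnj ((conj_transpose C *v v) $ i) * u $ i)"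
  unfolding matrix_vector_mult_def
  by (simp add: sum_distrib_left sum_distrib_right mult_ac) (rule sum.swap)

text \<open>\<open>matrix_inv\<close> is a choice among two-sided inverses. For square matrices a
  one-sided inverse is two-sided, so the choice has a candidate, and inverses are unique.\<close>

lemma matrix_inv_unique:
  fixes A B :: "complex^'n^'n"
  assumes "A ** B = mat 1"
  shows "matrix_inv A = B"
proof -
  have *: "B ** A = mat 1"
    using assms matrix_left_right_inverse by blast
  then have "A ** matrix_inv A = mat 1"
    using assms unfolding matrix_inv_def by (rule_tac someI2 [of _ B]) auto
  then show ?thesis
    by (metis * matrix_mul_assoc matrix_mul_lid matrix_mul_rid)
qed

lemma matrix_inv_mult:
  fixes A :: "complex^'n^'n"
  assumes "det A \<noteq> 0"
  shows "A ** matrix_inv A = mat 1" "matrix_inv A ** A = mat 1"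
proof -
  obtain B where "A ** B = mat 1"
    using assms unfolding invertible_det_nz [symmetric] invertible_def by blast
  moreover from this have "matrix_inv A = B"
    by (rule matrix_inv_unique)
  ultimately show "A ** matrix_inv A = mat 1" "matrix_inv A ** A = mat 1"
    using matrix_left_right_inverse by blast+
qed

section \<open>Positive-definite matrices and congruence\<close>

lemma hermitian_pos_def_cnj_nth: "hermitian_pos_def A \<Longrightarrow> cnj (A $ i $ j) = A $ j $ i"
  by (metis conj_transpose_nth hermitian_def hermitian_pos_def_def)

text \<open>The new form at \<open>v\<close> is the form of \<open>A\<close> at
  \<open>conj_transpose C *v v\<close>, a nonzero vector because \<open>C\<close> is
  invertible.\<close>

lemma hermitian_pos_def_congruence:
  assumes "hermitian_pos_def A" and "det C \<noteq> 0"
  shows "hermitian_pos_def (C ** A ** conj_transpose C)"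
  unfolding hermitian_pos_def_def
proof (intro conjI allI impI)
  show "hermitian (C ** A ** conj_transpose C)"
    using assms(1) by (simp add: hermitian_pos_def_def hermitian_def conj_transpose_mult matrix_mul_assoc)
next
  fix v :: "complex^'a" assume "v \<noteq> 0"
  let ?D = "conj_transpose C"
  have "det ?D \<noteq> 0"
    using assms(2) by (simp add: det_conj_transpose)
  then have "?D *v v \<noteq> 0"
    using \<open>v \<noteq> 0\<close> by (metis matrix_inv_mult(2) matrix_vector_mul_assoc matrix_vector_mul_lid
        matrix_vector_mult_0_right)
  then have "0 < Re (\<Sum>i\<in>UNIV. cnj ((?D *v v) $ i) * (A *v (?D *v v)) $ i)"
    using assms(1) unfolding hermitian_pos_def_def by blast
  also have "(\<Sum>i\<in>UNIV. cnj ((?D *v v) $ i) * (A *v (?D *v v)) $ i)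
      = (\<Sum>i\<in>UNIV. cnj (v $ i) * ((C ** A ** ?D) *v v) $ i)"
    by (subst sum_cnj_mult_matrix_vector [symmetric]) (simp add: matrix_vector_mul_assoc matrix_mul_assoc)
  finally show "0 < Re (\<Sum>i\<in>UNIV. cnj (v $ i) * ((C ** A ** ?D) *v v) $ i)" .
qed

text \<open>Evaluating the form at the basis vector \<open>axis k 1\<close> picks out the diagonal
  entry.\<close>

lemma hermitian_pos_def_nth_diag:
  assumes "hermitian_pos_def A"
  shows "0 < Re (A $ k $ k)" and "A $ k $ k = of_real (Re (A $ k $ k))"
proof -
  have "0 < Re (\<Sum>i\<in>UNIV. cnj (axis k 1 $ i) * (A *v axis k 1) $ i)"
    using assms by (simp add: hermitian_pos_def_def)
  also have "(\<Sum>i\<in>UNIV. cnj (axis k 1 $ i) * (A *v axis k 1) $ i) = A $ k $ k"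
    by (simp add: matrix_vector_mult_def axis_def if_distrib if_distribR cong: if_cong)
  finally show "0 < Re (A $ k $ k)" .
  show "A $ k $ k = of_real (Re (A $ k $ k))"
    using hermitian_pos_def_cnj_nth [OF assms, of k k] by (simp add: complex_eq_iff)
qed

section \<open>Symmetric Gaussian elimination\<close>

text \<open>One pivot step: \<open>E\<close> adds multiples of row \<open>k\<close> to the other
  rows and \<open>conj_transpose E\<close> does the same to the columns. What remains beside the
  positive pivot is its Schur complement.\<close>

lemma hermitian_pos_def_eliminate:
  fixes B :: "complex^'n^'n"
  assumes B: "hermitian_pos_def B"
  obtains E where "det E = 1"
    "E ** B ** conj_transpose E = (\<chi> i j. if i = k \<and> j = k then B $ k $ k
       else if i = k \<or> j = k then 0 else B $ i $ j - B $ i $ k * B $ k $ j / B $ k $ k)"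
proof -
  define e where "e i = - B $ i $ k / B $ k $ k" for i
  define E :: "complex^'n^'n" where
    "E = (\<chi> i j. if j = k then (if i = k then 1 else e i) else if i = j then 1 else 0)"
  \<comment> \<open>\<open>E\<close> is the identity with column \<open>k\<close> replaced by a
    vector. In this form Cramer's lemma gives the determinant as the \<open>k\<close>-th entry of
    that vector, which is 1.\<close>
  have "E = (\<chi> i j. if j = k then (mat 1 *v (\<chi> i. if i = k then 1 else e i)) $ i else mat 1 $ i $ j)"
    unfolding matrix_vector_mul_lid by (simp add: E_def vec_eq_iff mat_def)
  then have "det E = 1"
    by (simp only: cramer_lemma) simp
  have left: "(E ** M) $ i $ j = (if i = k then M $ k $ j else M $ i $ j + e i * M $ k $ j)" for M i j
  proof -
    have "(E ** M) $ i $ j = (\<Sum>l\<in>UNIV. (if l = i then M $ i $ j else 0)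
        + (if l = k then (if i = k then 0 else e i * M $ k $ j) else 0))"
      unfolding matrix_matrix_mult_def vec_lambda_beta by (intro sum.cong) (auto simp: E_def)
    then show ?thesis
      by (simp add: sum.distrib)
  qed
  \<comment> \<open>Column operations are the row operations \<open>left\<close> seen through
    conjugate transposition.\<close>
  have right: "(M ** conj_transpose E) $ i $ j
      = (if j = k then M $ i $ k else M $ i $ j + cnj (e j) * M $ i $ k)" for M i j
  proof -
    have "(M ** conj_transpose E) $ i $ j = cnj ((E ** conj_transpose M) $ j $ i)"
      unfolding conj_transpose_nth [symmetric] conj_transpose_mult conj_transpose_conj_transpose ..
    then show ?thesis
      by (simp add: left)
  qed
  have kk: "B $ k $ k \<noteq> 0"
    using hermitian_pos_def_nth_diag(1) [OF B, of k] by auto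
  have "E ** B ** conj_transpose E = (\<chi> i j. if i = k \<and> j = k then B $ k $ k
       else if i = k \<or> j = k then 0 else B $ i $ j - B $ i $ k * B $ k $ j / B $ k $ k)"
    using kk by (simp add: vec_eq_iff right left e_def hermitian_pos_def_cnj_nth [OF B])
  with \<open>det E = 1\<close> show thesis
    by (rule that)
qed

text \<open>\<open>S\<close> holds the indices still to be eliminated; off-diagonal entries live
  only inside \<open>S\<close>, so \<open>B\<close> is diagonal once \<open>S\<close> is empty. Each
  step can only lower diagonal entries, which gives the bound on the pivots. The equality clause is
  carried along because it later yields uniqueness of the minimiser.\<close>

lemma hermitian_pos_def_diagonalize_aux:
  fixes B :: "complex^'n^'n"
  assumes "finite S" and "hermitian_pos_def B"
    and "\<And>i j. i \<noteq> j \<Longrightarrow> i \<notin> S \<or> j \<notin> S \<Longrightarrow> B $ i $ j = 0"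
  shows "\<exists>E d. det E = 1 \<and> E ** B ** conj_transpose E = real_diag d
    \<and> (\<forall>i. 0 < d i \<and> d i \<le> Re (B $ i $ i))
    \<and> ((\<forall>i. d i = Re (B $ i $ i)) \<longrightarrow> B = real_diag d)"
  using assms
proof (induction S arbitrary: B rule: finite_induct)
  case empty
  note diag = hermitian_pos_def_nth_diag [OF empty(1)]
  have "B = real_diag (\<lambda>i. Re (B $ i $ i))"
    using diag(2) empty(2) by (simp add: vec_eq_iff)
  then show ?case
    using diag(1) by (intro exI [of _ "mat 1"] exI [of _ "\<lambda>i. Re (B $ i $ i)"]) simp
next
  case (insert k S)
  note B = insert.prems(1)
  note diag = hermitian_pos_def_nth_diag [OF B]
  obtain E where E: "det E = 1" and EB: "E ** B ** conj_transpose E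
      = (\<chi> i j. if i = k \<and> j = k then B $ k $ k
       else if i = k \<or> j = k then 0 else B $ i $ j - B $ i $ k * B $ k $ j / B $ k $ k)"
    using hermitian_pos_def_eliminate [OF B] by blast
  define B' where "B' = E ** B ** conj_transpose E"
  have B': "B' $ i $ j = (if i = k \<and> j = k then B $ k $ k
       else if i = k \<or> j = k then 0 else B $ i $ j - B $ i $ k * B $ k $ j / B $ k $ k)" for i j
    by (simp add: B'_def EB)
  have "hermitian_pos_def B'"
    unfolding B'_def by (rule hermitian_pos_def_congruence) (simp_all add: B E)
  moreover have "\<And>i j. i \<noteq> j \<Longrightarrow> i \<notin> S \<or> j \<notin> S \<Longrightarrow> B' $ i $ j = 0"
  proof -
    fix i j assume ij: "i \<noteq> j" "i \<notin> S \<or> j \<notin> S"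
    show "B' $ i $ j = 0"
    proof (cases "i = k \<or> j = k")
      case False
      \<comment> \<open>No fill-in: one of the indices lies outside \<open>insert k S\<close>, so a
        factor of the Schur correction vanishes as well.\<close>
      then have "B $ i $ j = 0" "B $ i $ k = 0 \<or> B $ k $ j = 0"
        using insert.prems(2) ij by auto
      then show ?thesis
        by (auto simp: B')
    qed (use ij in \<open>auto simp: B'\<close>)
  qed
  ultimately have "\<exists>E d. det E = 1 \<and> E ** B' ** conj_transpose E = real_diag d
    \<and> (\<forall>i. 0 < d i \<and> d i \<le> Re (B' $ i $ i))
    \<and> ((\<forall>i. d i = Re (B' $ i $ i)) \<longrightarrow> B' = real_diag d)"
    by (rule insert.IH)
  then obtain F d where F: "det F = 1" and FB: "F ** B' ** conj_transpose F = real_diag d"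
    and d: "\<And>i. 0 < d i" "\<And>i. d i \<le> Re (B' $ i $ i)"
    and eq: "(\<forall>i. d i = Re (B' $ i $ i)) \<Longrightarrow> B' = real_diag d"
    by blast
  have Re_B': "Re (B' $ i $ i) = Re (B $ i $ i) - (cmod (B $ i $ k))\<^sup>2 / Re (B $ k $ k)" if "i \<noteq> k" for i
  proof -
    have "B $ k $ i = cnj (B $ i $ k)"
      by (rule hermitian_pos_def_cnj_nth [OF B, symmetric])
    then have "B $ i $ k * B $ k $ i = of_real ((cmod (B $ i $ k))\<^sup>2)"
      by (simp add: complex_norm_square del: of_real_power)
    then have "B $ i $ k * B $ k $ i / B $ k $ k = of_real ((cmod (B $ i $ k))\<^sup>2 / Re (B $ k $ k))"
      by (metis diag(2) of_real_divide)
    then show ?thesis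
      using that by (simp add: B')
  qed
  have le: "Re (B' $ i $ i) \<le> Re (B $ i $ i)" for i
    using Re_B' [of i] diag(1) [of k] by (cases "i = k") (auto simp: B')
  have "B = real_diag d" if all: "\<forall>i. d i = Re (B $ i $ i)"
  proof -
    \<comment> \<open>The chain from \<open>d i\<close> through \<open>B'\<close> to
      \<open>B\<close> collapses, so the loss in \<open>Re_B'\<close> is zero. Hence row and column
      \<open>k\<close> were already clear and the elimination step changed nothing.\<close>
    have same: "Re (B' $ i $ i) = Re (B $ i $ i)" for i
      using all d(2) le by (metis order_antisym)
    have col: "B $ i $ k = 0" if "i \<noteq> k" for i
      using Re_B' [OF that] same [of i] diag(1) [of k] by simp
    have row: "B $ k $ i = 0" if "i \<noteq> k" for i
      using col [OF that] hermitian_pos_def_cnj_nth [OF B, of i k] by simp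
    have "B' = B"
      by (auto simp: vec_eq_iff B' col row)
    then show ?thesis
      using eq all same by simp
  qed
  moreover have "det (F ** E) = 1"
    by (simp add: det_mul E F)
  moreover have "(F ** E) ** B ** conj_transpose (F ** E) = real_diag d"
    using FB by (simp add: B'_def conj_transpose_mult matrix_mul_assoc)
  ultimately show ?case
    using d le by (meson order_trans)
qed

text \<open>Starting from \<open>S = UNIV\<close>, the support condition is vacuous. The determinant
  is the product of the pivots since \<open>det E = 1\<close>.\<close>

lemma hermitian_pos_def_diagonalize:
  fixes B :: "complex^'n^'n"
  assumes "hermitian_pos_def B"
  obtains E d where "det E = 1" "E ** B ** conj_transpose E = real_diag d"
    "\<And>i. 0 < d i" "\<And>i. d i \<le> Re (B $ i $ i)"
    "(\<And>i. d i = Re (B $ i $ i)) \<Longrightarrow> B = real_diag d"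
    "det B = of_real (\<Prod>i\<in>UNIV. d i)"
proof -
  obtain E d where *: "det E = 1" "E ** B ** conj_transpose E = real_diag d"
    "\<And>i. 0 < d i" "\<And>i. d i \<le> Re (B $ i $ i)"
    "(\<forall>i. d i = Re (B $ i $ i)) \<Longrightarrow> B = real_diag d"
    using hermitian_pos_def_diagonalize_aux [of UNIV B] assms by auto
  then have "det B = of_real (\<Prod>i\<in>UNIV. d i)"
    by (metis det_real_diag det_mul det_conj_transpose complex_cnj_one mult_1 mult.right_neutral)
  with * that show thesis
    by blast
qed

lemma hermitian_pos_def_det:
  assumes "hermitian_pos_def B"
  shows "0 < Re (det B)" and "det B = of_real (Re (det B))" and "det B \<noteq> 0"
proof -
  obtain d :: "'a \<Rightarrow> real" where "\<And>i. 0 < d i" and "det B = of_real (\<Prod>i\<in>UNIV. d i)"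
    using hermitian_pos_def_diagonalize [OF assms] by metis
  then show "0 < Re (det B)" and "det B = of_real (Re (det B))"
    by (simp_all only: Re_complex_of_real prod_pos)
  then show "det B \<noteq> 0"
    by auto
qed

text \<open>The inverse is congruent to \<open>A\<close>: with \<open>C\<close> the inverse,
  \<open>A ** conj_transpose C\<close> is the identity because \<open>A\<close> is Hermitian, so the
  congruence of \<open>A\<close> by \<open>C\<close> is \<open>C\<close> itself.\<close>

lemma hermitian_pos_def_inv:
  assumes "hermitian_pos_def A"
  shows "hermitian_pos_def (matrix_inv A)"
proof -
  let ?C = "matrix_inv A"
  note inv = matrix_inv_mult [OF hermitian_pos_def_det(3) [OF assms]]
  have "A ** conj_transpose ?C = mat 1"
    using inv(2) assms by (metis conj_transpose_mult conj_transpose_mat_1 hermitian_pos_def_def hermitian_def)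
  then have "?C ** A ** conj_transpose ?C = ?C"
    by (metis matrix_mul_assoc matrix_mul_rid)
  moreover have "det ?C \<noteq> 0"
    using inv(1) by (metis det_I det_mul mult_zero_right zero_neq_one)
  ultimately show ?thesis
    using hermitian_pos_def_congruence [OF assms, of ?C] by simp
qed

section \<open>Minimising a trace minus the log-determinant\<close>

lemma trace_minus_ln_det_ge:
  fixes B :: "complex^'n^'n"
  assumes "hermitian_pos_def B"
  shows "real CARD('n) \<le> Re (trace B) - ln (Re (det B))"
    and "Re (trace B) - ln (Re (det B)) = real CARD('n) \<Longrightarrow> B = mat 1"
proof -
  obtain d where d: "\<And>i. 0 < d i" "\<And>i. d i \<le> Re (B $ i $ i)"
    and diag: "(\<And>i. d i = Re (B $ i $ i)) \<Longrightarrow> B = real_diag d"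
    and det: "det B = of_real (\<Prod>i\<in>UNIV. d i)"
    using hermitian_pos_def_diagonalize [OF assms] by metis
  \<comment> \<open>Each index contributes two nonnegative amounts: the drop from diagonal entry to
    pivot, and the gap in \<open>ln x \<le> x - 1\<close>.\<close>
  define g where "g i = (Re (B $ i $ i) - d i) + (d i - 1 - ln (d i))" for i
  have ln: "ln (d i) \<le> d i - 1" for i
    by (rule ln_le_minus_one) (rule d)
  have nonneg: "0 \<le> g i" for i
    using d(2) [of i] ln [of i] by (simp add: g_def)
  have "ln (Re (det B)) = (\<Sum>i\<in>UNIV. ln (d i))"
    unfolding det Re_complex_of_real using d(1) by (intro ln_prod) (auto simp: less_imp_neq [symmetric])
  then have sum: "Re (trace B) - ln (Re (det B)) - real CARD('n) = (\<Sum>i\<in>UNIV. g i)"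
    by (simp add: g_def trace_def sum_subtractf sum.distrib)
  then show "real CARD('n) \<le> Re (trace B) - ln (Re (det B))"
    using nonneg sum_nonneg [of UNIV g] by simp
  assume "Re (trace B) - ln (Re (det B)) = real CARD('n)"
  with sum have "(\<Sum>i\<in>UNIV. g i) = 0"
    by simp
  then have "g i = 0" for i
    using nonneg by (simp add: sum_nonneg_eq_0_iff)
  \<comment> \<open>Both amounts vanish. The first makes \<open>B\<close> diagonal; the second, by
    strictness of the logarithm inequality away from 1, makes every pivot 1.\<close>
  then have "Re (B $ i $ i) = d i" "ln (d i) = d i - 1" for i
    using d(2) [of i] ln [of i] by (simp_all add: g_def) (smt (verit) g_def)+
  then have "d i = Re (B $ i $ i)" "d i = 1" for i
    using d(1) ln_eq_minus_one by auto
  then show "B = mat 1"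
    using diag by (simp add: vec_eq_iff mat_def)
qed

text \<open>Undoing the elimination with \<open>Q\<close>, the inverse of \<open>E\<close>, and
  taking \<open>R\<close> as the square root of the pivot matrix, the factor is
  \<open>P = conj_transpose (Q ** R)\<close>.\<close>

lemma hermitian_pos_def_factor:
  fixes A :: "complex^'n^'n"
  assumes "hermitian_pos_def A"
  obtains P where "A = conj_transpose P ** P" and "det P \<noteq> 0"
proof -
  obtain E d where E: "det E = 1" and diag: "E ** A ** conj_transpose E = real_diag d"
    and d: "\<And>i. 0 < d i"
    using hermitian_pos_def_diagonalize [OF assms] by metis
  define R where "R = real_diag (\<lambda>i. sqrt (d i))"
  define Q where "Q = matrix_inv E"
  have inv: "Q ** E = mat 1" and inv': "conj_transpose E ** conj_transpose Q = mat 1"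
    using matrix_inv_mult(2) [of E] by (simp_all add: Q_def E flip: conj_transpose_mult)
  have R: "R ** conj_transpose R = real_diag d"
  proof -
    have "complex_of_real (sqrt (d i)) * complex_of_real (sqrt (d i)) = complex_of_real (d i)" for i
      using less_imp_le [OF d] by (metis of_real_mult real_sqrt_mult_self abs_of_nonneg)
    then have "(R ** conj_transpose R) $ i $ j
        = (\<Sum>k\<in>UNIV. if k = i then real_diag d $ i $ j else 0)" for i j
      unfolding matrix_matrix_mult_def vec_lambda_beta by (intro sum.cong) (auto simp: R_def)
    then show ?thesis
      by (simp add: vec_eq_iff)
  qed
  have "A = (Q ** E) ** A ** (conj_transpose E ** conj_transpose Q)"
    by (simp add: inv inv')
  also have "\<dots> = Q ** (E ** A ** conj_transpose E) ** conj_transpose Q"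
    by (simp add: matrix_mul_assoc)
  also have "\<dots> = conj_transpose (conj_transpose (Q ** R)) ** conj_transpose (Q ** R)"
    by (simp add: diag conj_transpose_mult matrix_mul_assoc flip: R)
  finally have A: "A = conj_transpose (conj_transpose (Q ** R)) ** conj_transpose (Q ** R)" .
  moreover have "det (conj_transpose (Q ** R)) \<noteq> 0"
    using hermitian_pos_def_det(3) [OF assms] A by (metis det_mul mult_zero_right)
  ultimately show thesis
    by (rule that)
qed

text \<open>Reduction to the case \<open>A = mat 1\<close>: for
  \<open>B = P ** X ** conj_transpose P\<close>, cyclicity of the trace gives
  \<open>trace B = trace (A ** X)\<close>, while the logarithm of the determinant shifts by that of
  \<open>det A\<close>.\<close>

lemma trace_mult_minus_ln_det_ge:
  fixes A X :: "complex^'n^'n"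
  assumes A: "hermitian_pos_def A" and X: "hermitian_pos_def X"
  shows "real CARD('n) + ln (Re (det A)) \<le> Re (trace (A ** X)) - ln (Re (det X))"
    and "Re (trace (A ** X)) - ln (Re (det X)) = real CARD('n) + ln (Re (det A))
      \<longleftrightarrow> X = matrix_inv A"
proof -
  obtain P where P: "A = conj_transpose P ** P" and P0: "det P \<noteq> 0"
    using hermitian_pos_def_factor [OF A] .
  define B where "B = P ** X ** conj_transpose P"
  have B: "hermitian_pos_def B"
    unfolding B_def using X P0 by (rule hermitian_pos_def_congruence)
  have tr: "trace (A ** X) = trace B"
    unfolding B_def P by (metis matrix_mul_assoc trace_mul_sym)
  have "det B = det A * det X"
    by (simp add: B_def P det_mul)
  then have "Re (det B) = Re (det A) * Re (det X)"
    by (metis hermitian_pos_def_det(2) [OF A] hermitian_pos_def_det(2) [OF X] Re_complex_of_real of_real_mult)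
  then have ln: "ln (Re (det B)) = ln (Re (det A)) + ln (Re (det X))"
    using hermitian_pos_def_det(1) [OF A] hermitian_pos_def_det(1) [OF X] by (simp add: ln_mult)
  show "real CARD('n) + ln (Re (det A)) \<le> Re (trace (A ** X)) - ln (Re (det X))"
    using trace_minus_ln_det_ge(1) [OF B] by (simp add: tr ln)
  show "Re (trace (A ** X)) - ln (Re (det X)) = real CARD('n) + ln (Re (det A)) \<longleftrightarrow> X = matrix_inv A"
  proof
    assume "Re (trace (A ** X)) - ln (Re (det X)) = real CARD('n) + ln (Re (det A))"
    then have "P ** (X ** conj_transpose P) = mat 1"
      using trace_minus_ln_det_ge(2) [OF B] by (simp add: tr ln) (simp add: B_def matrix_mul_assoc)
    \<comment> \<open>The right inverse \<open>X ** conj_transpose P\<close> of \<open>P\<close> is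
      also a left inverse, and regrouping produces \<open>A\<close>.\<close>
    then have "X ** A = mat 1"
      using matrix_left_right_inverse by (metis P matrix_mul_assoc)
    then show "X = matrix_inv A"
      using matrix_inv_unique matrix_left_right_inverse by metis
  next
    assume "X = matrix_inv A"
    then have AX: "A ** X = mat 1"
      using matrix_inv_mult(1) hermitian_pos_def_det(3) [OF A] by blast
    then have "Re (det A) * Re (det X) = 1"
      by (metis \<open>Re (det B) = Re (det A) * Re (det X)\<close> \<open>det B = det A * det X\<close> det_I det_mul one_complex.sel(1))
    then have "ln (Re (det A)) + ln (Re (det X)) = 0"
      using hermitian_pos_def_det(1) [OF A] hermitian_pos_def_det(1) [OF X] by (metis ln_mult ln_one less_irrefl)
    then show "Re (trace (A ** X)) - ln (Re (det X)) = real CARD('n) + ln (Re (det A))"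
      by (simp add: AX trace_I)
  qed
qed

section \<open>The positive-definite cone and linearity of the trace\<close>

lemma hermitian_pos_def_scaleR:
  assumes "hermitian_pos_def A" and "0 < c"
  shows "hermitian_pos_def (c *\<^sub>R A)"
proof -
  have "(\<Sum>i\<in>UNIV. cnj (v $ i) * ((c *\<^sub>R A) *v v) $ i) = c *\<^sub>R (\<Sum>i\<in>UNIV. cnj (v $ i) * (A *v v) $ i)" for v
    by (simp add: matrix_vector_mult_def scaleR_sum_right sum_distrib_left)
  then show ?thesis
    using assms by (simp add: hermitian_pos_def_def hermitian_def vec_eq_iff)
qed

lemma hermitian_pos_def_add:
  assumes "hermitian_pos_def A" and "hermitian_pos_def B"
  shows "hermitian_pos_def (A + B)"
proof -
  have "(\<Sum>i\<in>UNIV. cnj (v $ i) * ((A + B) *v v) $ i)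
      = (\<Sum>i\<in>UNIV. cnj (v $ i) * (A *v v) $ i) + (\<Sum>i\<in>UNIV. cnj (v $ i) * (B *v v) $ i)" for v
    by (simp add: matrix_vector_mult_add_rdistrib distrib_left sum.distrib)
  moreover have "hermitian (A + B)"
    using assms by (simp add: hermitian_pos_def_def hermitian_def vec_eq_iff)
  ultimately show ?thesis
    using assms unfolding hermitian_pos_def_def by (simp only: plus_complex.sel) (blast intro: add_pos_pos)
qed

text \<open>The induction starts from singletons, as the empty sum 0 is not positive
  definite.\<close>

lemma hermitian_pos_def_sum:
  assumes "finite I" "I \<noteq> {}" "\<And>i. i \<in> I \<Longrightarrow> hermitian_pos_def (f i)"
  shows "hermitian_pos_def (\<Sum>i\<in>I. f i)"
  using assms by (induction rule: finite_ne_induct) (auto intro: hermitian_pos_def_add)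

lemma trace_scaleR_mult: "trace ((c *\<^sub>R A) ** X) = c *\<^sub>R trace (A ** X)"
  for A X :: "complex^'n^'n"
  by (simp add: trace_def matrix_matrix_mult_def scaleR_sum_right)

lemma trace_sum_mult: "trace ((\<Sum>i\<in>I. f i) ** X) = (\<Sum>i\<in>I. trace (f i ** X))"
  for X :: "complex^'n^'n"
proof -
  have zero: "trace (0 :: complex^'n^'n) = 0"
    by (simp add: trace_def)
  have add: "trace ((A + B) ** X) = trace (A ** X) + trace (B ** X)" for A B
    by (simp add: trace_def matrix_matrix_mult_def distrib_right sum.distrib)
  show ?thesis
    by (induction I rule: infinite_finite_induct) (simp_all add: zero add)
qed

section \<open>The divergence and its mean\<close>

text \<open>Isolates the dependence on \<open>X\<close> in the last bracket; the weight and the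
  remaining terms depend on \<open>Y\<close> alone, so a sum of divergences stays of the same
  type.\<close>

lemma TLD_divergence_eq:
  fixes X Y :: "complex^'n^'n"
  assumes X: "hermitian_pos_def X" and Y: "hermitian_pos_def Y"
  shows "TLD_divergence X Y = (1 / sqrt (1 + (frobenius_norm (matrix_inv Y))\<^sup>2))
    * (ln (Re (det Y)) - real CARD('n) + (Re (trace (matrix_inv Y ** X)) - ln (Re (det X))))"
proof -
  note dX = hermitian_pos_def_det [OF X] and dY = hermitian_pos_def_det [OF Y]
  have "det (matrix_inv X) * det X = 1"
    using matrix_inv_mult(2) [OF dX(3)] by (metis det_I det_mul)
  then have "det (Y ** matrix_inv X) = det Y / det X"
    using dX(3) by (simp add: det_mul field_simps)
  then have "Re (det (Y ** matrix_inv X)) = Re (det Y) / Re (det X)"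
    by (metis Re_complex_of_real dX(2) dY(2) of_real_divide)
  then show ?thesis
    using dX(1) dY(1) by (simp add: TLD_divergence_def ln_div)
qed

text \<open>The weights are normalised by the reciprocal of their sum, so the inverse of the mean is
  a weighted average of the inverses. The sum of the reciprocal weights would be a strictly larger
  factor once \<open>m\<close> is at least 2. The equivalence gives both existence and uniqueness of
  the minimiser.\<close>

theorem proposition8:
  fixes Xs :: "nat \<Rightarrow> complex^'n^'n" and X :: "complex^'n^'n" and m :: nat
  assumes "m \<ge> 1"
    and "\<And>i. i \<in> {1..m} \<Longrightarrow> hermitian_pos_def (Xs i)"
  shows "is_TLD_mean m Xs X \<longleftrightarrow>
    X = matrix_inv
      (inverse (\<Sum>j = 1..m. 1 / sqrt (1 + (frobenius_norm (matrix_inv (Xs j)))\<^sup>2)) *\<^sub>R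
        (\<Sum>i = 1..m. (1 / sqrt (1 + (frobenius_norm (matrix_inv (Xs i)))\<^sup>2)) *\<^sub>R
          matrix_inv (Xs i)))"
proof -
  define w where "w i = 1 / sqrt (1 + (frobenius_norm (matrix_inv (Xs i)))\<^sup>2)" for i
  define W where "W = (\<Sum>j = 1..m. w j)"
  define A where "A = inverse W *\<^sub>R (\<Sum>i = 1..m. w i *\<^sub>R matrix_inv (Xs i))"
  define f where "f X = 1 / real m * (\<Sum>i = 1..m. TLD_divergence X (Xs i))" for X
  define g where "g X = Re (trace (A ** X)) - ln (Re (det X))" for X
  define K where "K = (\<Sum>i = 1..m. w i * (ln (Re (det (Xs i))) - real CARD('n)))"
  have w: "0 < w i" for i
    unfolding w_def by (intro divide_pos_pos real_sqrt_gt_zero add_pos_nonneg) simp_all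
  have W: "0 < W"
    unfolding W_def using assms(1) w by (intro sum_pos) auto
  have A: "hermitian_pos_def A"
    unfolding A_def using assms w W
    by (intro hermitian_pos_def_scaleR hermitian_pos_def_sum hermitian_pos_def_inv) auto
  \<comment> \<open>On the cone the objective is an affine function of \<open>g\<close> with
    positive slope \<open>W / real m\<close>, so both have the same minimisers.\<close>
  have f: "f Y = 1 / real m * (K + W * g Y)" if Y: "hermitian_pos_def Y" for Y
  proof -
    have "Re (trace (A ** Y)) = inverse W * (\<Sum>i = 1..m. w i * Re (trace (matrix_inv (Xs i) ** Y)))"
      by (simp add: A_def trace_scaleR_mult trace_sum_mult)
    then have WA: "W * Re (trace (A ** Y)) = (\<Sum>i = 1..m. w i * Re (trace (matrix_inv (Xs i) ** Y)))"
      using W by (simp add: field_simps)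
    have "(\<Sum>i = 1..m. TLD_divergence Y (Xs i)) = (\<Sum>i = 1..m.
        w i * (ln (Re (det (Xs i))) - real CARD('n)) + w i * Re (trace (matrix_inv (Xs i) ** Y))
          - w i * ln (Re (det Y)))"
      by (intro sum.cong refl)
        (simp only: TLD_divergence_eq [OF Y assms(2)] w_def distrib_left right_diff_distrib add_diff_eq)
    also have "\<dots> = K + W * Re (trace (A ** Y)) - W * ln (Re (det Y))"
      unfolding WA by (simp add: sum.distrib sum_subtractf K_def W_def sum_distrib_right)
    finally show ?thesis
      by (simp add: f_def g_def right_diff_distrib add_diff_eq)
  qed
  have less: "f Y < f Z \<longleftrightarrow> g Y < g Z" if "hermitian_pos_def Y" "hermitian_pos_def Z" for Y Z
    using assms(1) W by (simp add: f that divide_less_cancel)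
  note min = trace_mult_minus_ln_det_ge [OF A, folded g_def]
  have inv: "hermitian_pos_def (matrix_inv A)"
    using A by (rule hermitian_pos_def_inv)
  have "is_arg_min f hermitian_pos_def X \<longleftrightarrow> X = matrix_inv A"
  proof
    assume *: "is_arg_min f hermitian_pos_def X"
    \<comment> \<open>At \<open>matrix_inv A\<close> the function \<open>g\<close> attains its lower
      bound; a minimiser cannot exceed that value, so the equality case applies to it.\<close>
    then have X: "hermitian_pos_def X" and "\<not> g (matrix_inv A) < g X"
      using inv less by (auto simp: is_arg_min_def)
    then show "X = matrix_inv A"
      using min(1) [OF X] min(2) [OF X] min(2) [OF inv] by simp
  next
    assume X: "X = matrix_inv A"
    have "\<not> f Y < f (matrix_inv A)" if "hermitian_pos_def Y" for Y
      using less [OF that inv] min(1) [OF that] min(2) [OF inv] by simp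
    then show "is_arg_min f hermitian_pos_def X"
      using inv by (auto simp: is_arg_min_def X)
  qed
  then show ?thesis
    unfolding is_TLD_mean_def f_def [symmetric] A_def W_def w_def .
qed

end
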